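(* Let $(W_t)_{t\in[0,1]}$ be a $d$-dimensional standard Brownian motion, $d\ge1$, defined on a probability space $(\Omega,\mathcal A,\mathbb P)$, let $(k(n))_{n\ge1}$ be a sequence of positive integers, and define $$\mu_n^\omega=\frac1{k(n)}\sum_{j=1}^{k(n)}\delta_{x_{n,j}(\omega)},\qquad x_{n,j}(\omega)=\Big(\frac{k(n)}n\Big)^{1/2}\big(W_{j/k(n)}(\omega)-W_{(j-1)/k(n)}(\omega)\big).$$ Let $R>0$. Suppose that there exists a positive sequence $(\epsilon_n)_{n\ge1}$ converging to $0$ such that $$\sum_{n\ge1}\exp\big(-\sqrt{\epsilon_n}\,[\log(k(n))-n(1+\sqrt{\epsilon_n})R^2/2]\big)\,\epsilon_n^{-1}<\infty.$$ Then, with probability 1, for every Borel subset $\Gamma$ of the open ball $\{x\in\mathbb R^d:\|x\|<R\}$, $$-\inf_{x\in\mathring\Gamma}I(x)\le\liminf_{n\to\infty}\frac1n\log\mu_n^\omega(\Gamma)\le\limsup_{n\to\infty}\frac1n\log\mu_n^\omega(\Gamma)\le-\inf_{x\in\overline\Gamma}I(x),$$ with $I(x)=\|x\|^2/2$.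
   Context: $\mathring\Gamma$ and $\overline\Gamma$ denote interior and closure in $\mathbb R^d$; $\|\cdot\|$ is the Euclidean norm; $\inf\emptyset=+\infty$. *)

theory Defs
  imports "HOL-Probability.Probability"
begin

text \<open>
  The increment over \<open>[s, t]\<close> has law \<open>N(0, (t - s) I_d)\<close>, given by its Lebesgue density.
  The starting point and the continuity of paths are required almost surely only, and \<open>W\<close> is
  unconstrained outside the time interval \<open>[0, 1]\<close>.
\<close>

definition gaussian_density :: "real \<Rightarrow> real ^ 'd \<Rightarrow> real" where
  "gaussian_density v x =
     (2 * pi * v) powr (- (real CARD('d) / 2)) * exp (- ((norm x)\<^sup>2 / (2 * v)))"

definition standard_brownian_motion ::
    "'a measure \<Rightarrow> (real \<Rightarrow> 'a \<Rightarrow> real ^ 'd) \<Rightarrow> bool" where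
  "standard_brownian_motion M W \<longleftrightarrow>
     prob_space M \<and>
     (\<forall>t\<in>{0..1}. W t \<in> borel_measurable M) \<and>
     (AE \<omega> in M. W 0 \<omega> = 0) \<and>
     (AE \<omega> in M. continuous_on {0..1} (\<lambda>t. W t \<omega>)) \<and>
     (\<forall>s t. 0 \<le> s \<and> s < t \<and> t \<le> 1 \<longrightarrow>
        distributed M lborel (\<lambda>\<omega>. W t \<omega> - W s \<omega>) (\<lambda>x. ennreal (gaussian_density (t - s) x))) \<and>
     (\<forall>(m::nat) (t :: nat \<Rightarrow> real). 0 \<le> t 0 \<and> (\<forall>i<m. t i < t (Suc i)) \<and> t m \<le> 1 \<longrightarrow>
        prob_space.indep_vars M (\<lambda>_. borel) (\<lambda>i \<omega>. W (t (Suc i)) \<omega> - W (t i) \<omega>) {..<m})"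

definition scaled_increment ::
    "(real \<Rightarrow> 'a \<Rightarrow> real ^ 'd) \<Rightarrow> (nat \<Rightarrow> nat) \<Rightarrow> nat \<Rightarrow> nat \<Rightarrow> 'a \<Rightarrow> real ^ 'd" where
  "scaled_increment W k n j \<omega> =
     sqrt (real (k n) / real n) *\<^sub>R (W (real j / real (k n)) \<omega> - W ((real j - 1) / real (k n)) \<omega>)"

text \<open>\<open>return borel x\<close> is the Dirac measure at \<open>x\<close>.\<close>

definition empirical_measure ::
    "(real \<Rightarrow> 'a \<Rightarrow> real ^ 'd) \<Rightarrow> (nat \<Rightarrow> nat) \<Rightarrow> nat \<Rightarrow> 'a \<Rightarrow> (real ^ 'd) measure" where
  "empirical_measure W k n \<omega> =
     measure_of UNIV (sets borel)
       (\<lambda>A. ennreal (1 / real (k n)) *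
            (\<Sum>j = 1..k n. emeasure (return borel (scaled_increment W k n j \<omega>)) A))"

lemma space_empirical_measure [simp]: "space (empirical_measure W k n \<omega>) = UNIV"
  by (simp add: empirical_measure_def space_measure_of_conv)

lemma sets_empirical_measure [simp, measurable_cong]:
  "sets (empirical_measure W k n \<omega>) = sets borel"
  using sets.sigma_sets_eq[of borel] by (simp add: empirical_measure_def sets_measure_of_conv)

lemma emeasure_empirical_measure:
  fixes W :: "real \<Rightarrow> 'a \<Rightarrow> real ^ 'd"
  assumes "A \<in> sets borel"
  shows "emeasure (empirical_measure W k n \<omega>) A =
     ennreal (1 / real (k n)) *
       (\<Sum>j = 1..k n. emeasure (return borel (scaled_increment W k n j \<omega>)) A)"
proof (rule emeasure_measure_of[OF empirical_measure_def])
  let ?D = "\<lambda>j. return borel (scaled_increment W k n j \<omega>)"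
  let ?m = "\<lambda>A. ennreal (1 / real (k n)) * (\<Sum>j = 1..k n. emeasure (?D j) A)"
  show "positive (sets (empirical_measure W k n \<omega>)) ?m"
    by (simp add: positive_def)
  show "countably_additive (sets (empirical_measure W k n \<omega>)) ?m"
  proof (rule countably_additiveI)
    fix B :: "nat \<Rightarrow> (real ^ 'd) set"
    assume B: "range B \<subseteq> sets (empirical_measure W k n \<omega>)" "disjoint_family B"
    have D: "(\<Sum>i. emeasure (?D j) (B i)) = emeasure (?D j) (\<Union>i. B i)" for j
      using B by (intro suminf_emeasure) auto
    have "(\<Sum>i. ?m (B i)) = ennreal (1 / real (k n)) * (\<Sum>j = 1..k n. \<Sum>i. emeasure (?D j) (B i))"
      by (simp add: suminf_sum)
    then show "(\<Sum>i. ?m (B i)) = ?m (\<Union>i. B i)"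
      by (simp only: D)
  qed
qed (use assms in auto)

text \<open>The real \<open>ln\<close> has \<open>ln 0 = 0\<close>; the extended logarithm takes the value \<open>-\<infinity>\<close> there.\<close>

definition elog :: "real \<Rightarrow> ereal" where
  "elog r = (if r = 0 then - \<infinity> else ereal (ln r))"

definition rate :: "real ^ 'd \<Rightarrow> real" where
  "rate x = (norm x)\<^sup>2 / 2"

end

theory Submission
  imports Defs
begin

text \<open>
  For fixed \<open>n\<close> the points \<open>x\<^bsub>n,j\<^esub>\<close> are independent with law \<open>N(0, I\<^sub>d / n)\<close>, whose mass near
  \<open>x\<close> has exponential rate \<open>I(x) = \<parallel>x\<parallel>\<^sup>2 / 2\<close>. The theorem says that one realization of the \<open>k(n)\<close>
  points reproduces these rates, simultaneously for all Borel sets in the ball of radius \<open>R\<close>. The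
  first Borel--Cantelli lemma turns exponentially small failure probabilities into almost sure
  statements, so it has to be applied to countably many sets from which every \<open>\<Gamma>\<close> can be handled.

  Upper bound. If \<open>b\<close> lies below the infimum of \<open>I\<close> over the closure of \<open>\<Gamma>\<close>, then
  \<open>\<Gamma> \<subseteq> {x. b \<le> I(x)}\<close>, so these sets with rational \<open>b\<close> suffice. A point falls in
  \<open>{x. b \<le> I(x)}\<close> with probability at most \<open>C exp (- n (1 - \<delta>) b)\<close> for large \<open>n\<close> (\<open>prob_rate_ge_le\<close>), and Markov's
  inequality (\<open>prob_many_hits_le\<close>) transfers the rate to the empirical measure for every \<open>a < b\<close>
  (\<open>AE_empirical_rate_ge_le\<close>).

  Lower bound. Near an interior point \<open>x\<close> of \<open>\<Gamma>\<close> there is a member \<open>U\<close> of a countable basis with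
  \<open>U \<subseteq> \<Gamma>\<close> and \<open>I < b\<close> on \<open>U\<close>, where \<open>b\<close> is rational and as close to \<open>I(x)\<close> as desired. A point
  falls in \<open>U\<close> with probability at least \<open>p exp (- n b)\<close> (\<open>prob_open_ge\<close>). Since \<open>I(x) < R\<^sup>2 / 2\<close>, one
  may take \<open>b < R\<^sup>2 / 2\<close>. The terms of the convergent series are eventually below \<open>1\<close>, and this gives
  \<open>k(n) \<ge> exp (n R\<^sup>2 / 2)\<close> (\<open>sample_size_eventually_large\<close>). Hence the expected number of points in
  \<open>U\<close> grows exponentially, and the Chernoff bound \<open>prob_few_hits_le\<close> makes it very unlikely that fewer
  than a quarter of them are present (\<open>AE_empirical_open_ge\<close>).
\<close>

section \<open>Gaussian densities\<close>

lemma sqrt_power_eq_powr: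
  assumes "0 < q"
  shows "sqrt q ^ m = q powr (real m / 2)"
proof -
  have "sqrt q ^ m = sqrt q powr real m"
    using assms by (simp add: powr_realpow)
  also have "\<dots> = q powr (real m / 2)"
    using assms by (simp add: powr_half_sqrt[symmetric] powr_powr)
  finally show ?thesis .
qed

lemma gaussian_density_nonneg: "0 \<le> gaussian_density v x"
  by (simp add: gaussian_density_def)

lemma gaussian_density_measurable [measurable]: "gaussian_density v \<in> borel_measurable borel"
  unfolding gaussian_density_def by measurable

text \<open>
  The tail estimate behind the upper bound: on the region where the exponent is at least \<open>t\<close>, the fraction \<open>1 - \<delta>\<close> of
  the exponent yields the exponential factor, and the fraction \<open>\<delta>\<close> that remains is, up to
  normalization, a Gaussian of variance \<open>v / \<delta>\<close>. Integrating the latter gives total mass one.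
\<close>

lemma gaussian_density_le_flattened:
  fixes x :: "real ^ 'd"
  assumes "0 < v" "0 < \<delta>" "\<delta> \<le> 1" and t: "t \<le> (norm x)\<^sup>2 / (2 * v)"
  shows "gaussian_density v x \<le>
    \<delta> powr (- (real CARD('d) / 2)) * exp (- ((1 - \<delta>) * t)) * gaussian_density (v / \<delta>) x"
proof -
  let ?q = "(norm x)\<^sup>2 / (2 * v)" and ?e = "- (real CARD('d) / 2)"
  have "?q = \<delta> * ?q + (1 - \<delta>) * ?q" by (simp only: left_diff_distrib)
  also have "\<dots> \<ge> \<delta> * ?q + (1 - \<delta>) * t"
    using assms by (intro add_left_mono mult_left_mono) auto
  finally have "exp (- ?q) \<le> exp (- ((1 - \<delta>) * t)) * exp (- (\<delta> * ?q))"
    by (simp flip: exp_add)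
  then have "(2 * pi * v) powr ?e * exp (- ?q) \<le>
      (\<delta> powr ?e * (2 * pi * (v / \<delta>)) powr ?e) * (exp (- ((1 - \<delta>) * t)) * exp (- (\<delta> * ?q)))"
    using assms by (simp flip: powr_mult add: mult_left_mono)
  then show ?thesis
    by (simp add: gaussian_density_def mult_ac)
qed

lemma gaussian_density_ge:
  fixes x :: "real ^ 'd"
  assumes "(norm x)\<^sup>2 / (2 * v) \<le> t"
  shows "(2 * pi * v) powr (- (real CARD('d) / 2)) * exp (- t) \<le> gaussian_density v x"
  using assms by (auto simp: gaussian_density_def intro!: mult_left_mono)

section \<open>Empirical frequencies of independent variables\<close>

text \<open>
  The lower Chernoff bound with exponential parameter \<open>1\<close>: each factor of \<open>E (exp (- hits))\<close> is
  \<open>1 - (1 - 1 / e) q \<le> exp (- p / 2)\<close>, because \<open>1 - 1 / e \<ge> 1 / 2\<close>, and half of the resulting exponent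
  pays for Markov's inequality at the level of a quarter of the expected count. The error decays in
  the expected count \<open>card J * p\<close>, whereas an additive deviation bound would only see \<open>card J * p\<^sup>2\<close>,
  which may tend to zero here.
\<close>

lemma (in prob_space) prob_few_hits_le:
  fixes X :: "'i \<Rightarrow> 'a \<Rightarrow> 'b :: topological_space"
  assumes J: "finite J" and ind: "indep_vars (\<lambda>_. borel) X J" and A: "A \<in> sets borel"
    and p: "\<And>j. j \<in> J \<Longrightarrow> p \<le> prob (X j -` A \<inter> space M)"
  shows "prob {\<omega> \<in> space M. (\<Sum>j\<in>J. indicator A (X j \<omega>)) \<le> real (card J) * p / 4}
           \<le> exp (- (real (card J) * p / 4))"
proof -
  have X[measurable]: "X j \<in> borel_measurable M" if "j \<in> J" for j
    using ind that by (auto simp: indep_vars_def)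
  note A[measurable]
  define f :: "'b \<Rightarrow> real" where "f = (\<lambda>x. exp (- indicator A x))"
  have f[measurable]: "f \<in> borel_measurable borel"
    unfolding f_def by measurable
  have f_eq: "f x = 1 - (1 - exp (- 1)) * indicator A x" for x
    by (auto simp: f_def indicator_def)
  have int: "integrable M (\<lambda>\<omega>. f (X j \<omega>))" if "j \<in> J" for j
    using that by (intro integrable_const_bound[where B = 1]) (auto simp: f_def indicator_def)
  have indf: "indep_vars (\<lambda>_. borel) (\<lambda>j \<omega>. f (X j \<omega>)) J"
    using ind by (rule indep_vars_compose2) simp
  have exp1: "exp (- 1 :: real) \<le> 1 / 2"
    using exp_ge_add_one_self[of "1::real"] by (simp add: exp_minus field_simps)
  have E: "expectation (\<lambda>\<omega>. f (X j \<omega>)) \<le> exp (- (p / 2))" if j: "j \<in> J" for j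
  proof -
    let ?q = "prob (X j -` A \<inter> space M)"
    have meas: "X j -` A \<inter> space M \<in> sets M"
      using j by measurable
    have ind_eq: "indicator A (X j \<omega>) = (indicator (X j -` A \<inter> space M) \<omega> :: real)"
      if "\<omega> \<in> space M" for \<omega>
      using that by (auto simp: indicator_def)
    have "expectation (\<lambda>\<omega>. f (X j \<omega>)) =
        expectation (\<lambda>\<omega>. 1 - (1 - exp (- 1)) * indicator (X j -` A \<inter> space M) \<omega>)"
      by (intro Bochner_Integration.integral_cong) (auto simp: f_eq ind_eq)
    also have "\<dots> = 1 - (1 - exp (- 1)) * ?q"
      using meas by (subst Bochner_Integration.integral_diff) (auto simp: prob_space less_top[symmetric])
    also have "\<dots> \<le> 1 - (1 / 2) * ?q"
      using exp1 by (intro diff_left_mono mult_right_mono) auto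
    also have "\<dots> \<le> 1 + (- (p / 2))"
      using p[OF j] by simp
    also have "\<dots> \<le> exp (- (p / 2))"
      by (rule exp_ge_add_one_self)
    finally show ?thesis .
  qed
  have prod_f: "(\<Prod>j\<in>J. f (X j \<omega>)) = exp (- (\<Sum>j\<in>J. indicator A (X j \<omega>)))" for \<omega>
    by (simp add: f_def exp_sum[OF J] sum_negf[symmetric])
  let ?a = "real (card J) * p / 4"
  have "expectation (\<lambda>\<omega>. \<Prod>j\<in>J. f (X j \<omega>)) = (\<Prod>j\<in>J. expectation (\<lambda>\<omega>. f (X j \<omega>)))"
    by (rule indep_vars_lebesgue_integral[OF J indf int])
  also have "\<dots> \<le> (\<Prod>j\<in>J. exp (- (p / 2)))"
    using E by (intro prod_mono) (auto simp: f_def)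
  also have "\<dots> = exp (- ?a) * exp (- ?a)"
    by (simp flip: exp_add exp_of_nat_mult)
  finally have le: "expectation (\<lambda>\<omega>. \<Prod>j\<in>J. f (X j \<omega>)) \<le> exp (- ?a) * exp (- ?a)" .
  have "{\<omega> \<in> space M. (\<Sum>j\<in>J. indicator A (X j \<omega>)) \<le> ?a} =
      {\<omega> \<in> space M. exp (- ?a) \<le> (\<Prod>j\<in>J. f (X j \<omega>))}"
    by (simp add: prod_f)
  also have "prob \<dots> \<le> expectation (\<lambda>\<omega>. \<Prod>j\<in>J. f (X j \<omega>)) / exp (- ?a)"
    using indep_vars_integrable[OF J indf int]
    by (intro integral_Markov_inequality_measure[where A = "{}"]) (auto simp: f_def prod_nonneg)
  also have "\<dots> \<le> exp (- ?a) * exp (- ?a) / exp (- ?a)"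
    using le by (intro divide_right_mono) auto
  finally show ?thesis by simp
qed

lemma (in prob_space) prob_many_hits_le:
  fixes X :: "'i \<Rightarrow> 'a \<Rightarrow> 'b :: topological_space"
  assumes J: "finite J" and X: "\<And>j. j \<in> J \<Longrightarrow> X j \<in> borel_measurable M" and A: "A \<in> sets borel"
    and p: "\<And>j. j \<in> J \<Longrightarrow> prob (X j -` A \<inter> space M) \<le> p" and a: "0 < a"
  shows "prob {\<omega> \<in> space M. a \<le> (\<Sum>j\<in>J. indicator A (X j \<omega>))} \<le> real (card J) * p / a"
proof -
  note X[measurable] A[measurable]
  let ?I = "\<lambda>j \<omega>. indicator (X j -` A \<inter> space M) \<omega> :: real"
  have meas: "X j -` A \<inter> space M \<in> sets M" if "j \<in> J" for j
    using that by measurable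
  have int: "integrable M (\<lambda>\<omega>. \<Sum>j\<in>J. ?I j \<omega>)"
    using meas by (auto simp: less_top[symmetric])
  have "{\<omega> \<in> space M. a \<le> (\<Sum>j\<in>J. indicator A (X j \<omega>))} =
      {\<omega> \<in> space M. a \<le> (\<Sum>j\<in>J. ?I j \<omega>)}"
    by (intro Collect_cong conj_cong refl arg_cong2[where f = "(\<le>)"] sum.cong)
      (auto simp: indicator_def)
  also have "prob \<dots> \<le> expectation (\<lambda>\<omega>. \<Sum>j\<in>J. ?I j \<omega>) / a"
    using int a by (intro integral_Markov_inequality_measure[where A = "{}"]) (auto intro!: sum_nonneg)
  also have "expectation (\<lambda>\<omega>. \<Sum>j\<in>J. ?I j \<omega>) = (\<Sum>j\<in>J. prob (X j -` A \<inter> space M))"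
    using meas by (subst Bochner_Integration.integral_sum) (auto simp: less_top[symmetric])
  also have "(\<Sum>j\<in>J. prob (X j -` A \<inter> space M)) / a \<le> real (card J) * p / a"
    using a sum_bounded_above[of J "\<lambda>j. prob (X j -` A \<inter> space M)" p] p
    by (intro divide_right_mono) auto
  finally show ?thesis .
qed

section \<open>Exponential rates\<close>

lemma elog_mono: "0 \<le> x \<Longrightarrow> x \<le> y \<Longrightarrow> elog x \<le> elog y"
  by (auto simp: elog_def)

text \<open>
  Prefactors that do not depend on \<open>n\<close> disappear on the scale \<open>log / n\<close>, so the probability
  estimates may be as crude as constants allow.
\<close>

lemma rescaled_elog_exponential_tendsto:
  assumes "0 < C"
  shows "(\<lambda>n. ereal (1 / real n) * elog (C * exp (- (real n * b)))) \<longlonglongrightarrow> ereal (- b)"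
proof -
  have "(\<lambda>n. ln C / real n - b) \<longlonglongrightarrow> 0 - b"
    by (intro tendsto_diff tendsto_const lim_const_over_n)
  then have "(\<lambda>n. ereal (ln C / real n - b)) \<longlonglongrightarrow> ereal (- b)"
    by simp
  moreover have "\<forall>\<^sub>F n in sequentially.
      ereal (ln C / real n - b) = ereal (1 / real n) * elog (C * exp (- (real n * b)))"
    using eventually_gt_at_top[of 0]
    by eventually_elim (use assms in \<open>simp add: elog_def ln_mult field_simps\<close>)
  ultimately show ?thesis
    by (rule Lim_transform_eventually)
qed

lemma liminf_rescaled_elog_ge:
  assumes "0 < C" "\<forall>\<^sub>F n in sequentially. C * exp (- (real n * b)) \<le> m n"
  shows "ereal (- b) \<le> liminf (\<lambda>n. ereal (1 / real n) * elog (m n))"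
proof -
  have "ereal (- b) = liminf (\<lambda>n. ereal (1 / real n) * elog (C * exp (- (real n * b))))"
    using lim_imp_Liminf[OF _ rescaled_elog_exponential_tendsto[OF assms(1)]] by simp
  also have "\<dots> \<le> liminf (\<lambda>n. ereal (1 / real n) * elog (m n))"
  proof (rule Liminf_mono)
    show "\<forall>\<^sub>F n in sequentially. ereal (1 / real n) * elog (C * exp (- (real n * b)))
        \<le> ereal (1 / real n) * elog (m n)"
      using assms(2) by eventually_elim (use assms(1) in \<open>auto intro!: ereal_mult_left_mono elog_mono\<close>)
  qed
  finally show ?thesis .
qed

lemma limsup_rescaled_elog_le:
  assumes "0 < C" "\<forall>\<^sub>F n in sequentially. m n \<le> C * exp (- (real n * b))" "\<And>n. 0 \<le> m n"
  shows "limsup (\<lambda>n. ereal (1 / real n) * elog (m n)) \<le> ereal (- b)"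
proof -
  have "limsup (\<lambda>n. ereal (1 / real n) * elog (m n)) \<le>
      limsup (\<lambda>n. ereal (1 / real n) * elog (C * exp (- (real n * b))))"
  proof (rule Limsup_mono)
    show "\<forall>\<^sub>F n in sequentially. ereal (1 / real n) * elog (m n) \<le>
        ereal (1 / real n) * elog (C * exp (- (real n * b)))"
      using assms(2) by eventually_elim (use assms(3) in \<open>auto intro!: ereal_mult_left_mono elog_mono\<close>)
  qed
  also have "\<dots> = ereal (- b)"
    using lim_imp_Limsup[OF _ rescaled_elog_exponential_tendsto[OF assms(1)]] by simp
  finally show ?thesis .
qed

lemma summable_exponential_decay:
  assumes "0 < c"
  shows "summable (\<lambda>n. exp (- (real n * c)))"
proof -
  have "summable (\<lambda>n. exp (- c) ^ n)"
    using assms by (intro summable_geometric) auto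
  then show ?thesis
    by (simp flip: exp_of_nat_mult)
qed

lemma exp_minus_le_inverse:
  fixes z :: real
  assumes "0 < z"
  shows "exp (- z) \<le> inverse z"
  unfolding exp_minus
  using assms exp_ge_add_one_self[of z] by (intro le_imp_inverse_le) linarith+

lemma (in prob_space) AE_eventually_not_of_exponential_decay:
  assumes "\<And>n. E n \<in> sets M" "0 < c"
    and le: "\<forall>\<^sub>F n in sequentially. prob (E n) \<le> C * exp (- (real n * c))"
  shows "AE \<omega> in M. \<forall>\<^sub>F n in sequentially. \<omega> \<notin> E n"
proof -
  have "summable (\<lambda>n. C * exp (- (real n * c)))"
    using assms by (intro summable_mult summable_exponential_decay)
  then have "summable (\<lambda>n. prob (E n))"
    by (rule summable_comparison_test_ev[rotated]) (use le in simp)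
  then have "AE \<omega> in M. \<forall>\<^sub>F n in sequentially. \<omega> \<in> space M - E n"
    using assms by (intro borel_cantelli_AE1) (auto simp: less_top[symmetric])
  then show ?thesis
    by eventually_elim (auto elim: eventually_mono)
qed

section \<open>The empirical measures of Brownian increments\<close>

lemma measure_empirical_measure:
  fixes W :: "real \<Rightarrow> 'a \<Rightarrow> real ^ 'd"
  assumes "A \<in> sets borel"
  shows "measure (empirical_measure W k n \<omega>) A =
    (\<Sum>i<k n. indicator A (scaled_increment W k n (Suc i) \<omega>)) / real (k n)"
proof -
  have "emeasure (empirical_measure W k n \<omega>) A =
      ennreal (1 / real (k n)) * (\<Sum>j=1..k n. ennreal (indicator A (scaled_increment W k n j \<omega>)))"
    using assms by (simp add: emeasure_empirical_measure ennreal_indicator)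
  also have "\<dots> = ennreal ((\<Sum>j=1..k n. indicator A (scaled_increment W k n j \<omega>)) / real (k n))"
    by (subst sum_ennreal) (auto simp: ennreal_mult'[symmetric] sum_nonneg)
  also have "(\<Sum>j=1..k n. indicator A (scaled_increment W k n j \<omega>)) =
      (\<Sum>i<k n. indicator A (scaled_increment W k n (Suc i) \<omega>) :: real)"
    by (simp add: sum.atLeast1_atMost_eq)
  finally show ?thesis
    by (simp add: measure_def sum_nonneg)
qed

locale brownian_increments = prob_space M for M :: "'a measure" +
  fixes W :: "real \<Rightarrow> 'a \<Rightarrow> real ^ 'd" and k :: "nat \<Rightarrow> nat"
  assumes bm: "standard_brownian_motion M W"
    and k_pos: "\<And>n. 1 \<le> n \<Longrightarrow> 0 < k n"
begin

lemma increment_distributed: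
  assumes "0 \<le> s" "s < t" "t \<le> 1"
  shows "distributed M lborel (\<lambda>\<omega>. W t \<omega> - W s \<omega>) (\<lambda>x. ennreal (gaussian_density (t - s) x))"
  using bm assms by (auto simp: standard_brownian_motion_def)

text \<open>
  The normalization is read off from the process: \<open>gaussian_density v\<close> is the density of \<open>W v - W 0\<close>.
  This restricts \<open>v\<close> to lengths of time intervals in \<open>[0, 1]\<close>.
\<close>

lemma nn_integral_gaussian_density:
  assumes "0 < v" "v \<le> 1"
  shows "(\<integral>\<^sup>+x. ennreal (gaussian_density v (x :: real ^ 'd)) \<partial>lborel) = 1"
  using distributed_emeasure[OF increment_distributed[of 0 v], of UNIV] assms emeasure_space_1
  by simp

lemma scaled_increment_measurable [measurable]:
  assumes "i < k n"
  shows "scaled_increment W k n (Suc i) \<in> borel_measurable M"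
proof -
  have W: "W t \<in> borel_measurable M" if "t \<in> {0..1}" for t
    using bm that by (auto simp: standard_brownian_motion_def)
  have [measurable]: "W (real (Suc i) / real (k n)) \<in> borel_measurable M"
      "W ((real (Suc i) - 1) / real (k n)) \<in> borel_measurable M"
    using assms by (auto intro!: W)
  show ?thesis
    unfolding scaled_increment_def by measurable
qed

lemma indep_scaled_increments:
  assumes "1 \<le> n"
  shows "indep_vars (\<lambda>_. borel) (\<lambda>i. scaled_increment W k n (Suc i)) {..<k n}"
proof -
  define t where "t = (\<lambda>i. real i / real (k n))"
  have "0 \<le> t 0 \<and> (\<forall>i<k n. t i < t (Suc i)) \<and> t (k n) \<le> 1"
    using k_pos[OF assms] by (auto simp: t_def divide_strict_right_mono)
  then have "indep_vars (\<lambda>_. borel) (\<lambda>i \<omega>. W (t (Suc i)) \<omega> - W (t i) \<omega>) {..<k n}"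
    using bm unfolding standard_brownian_motion_def by blast
  then have "indep_vars (\<lambda>_. borel)
      (\<lambda>i \<omega>. sqrt (real (k n) / real n) *\<^sub>R (W (t (Suc i)) \<omega> - W (t i) \<omega>)) {..<k n}"
    by (rule indep_vars_compose2) simp
  then show ?thesis
    by (simp add: scaled_increment_def[abs_def] t_def)
qed

lemma emeasure_scaled_increment:
  fixes A :: "(real ^ 'd) set"
  assumes "1 \<le> n" "i < k n" and A[measurable]: "A \<in> sets borel"
  shows "emeasure M (scaled_increment W k n (Suc i) -` A \<inter> space M) =
    (\<integral>\<^sup>+x. ennreal (gaussian_density (1 / real (k n)) x) *
       indicator A (sqrt (real (k n) / real n) *\<^sub>R x) \<partial>lborel)"
proof -
  let ?c = "sqrt (real (k n) / real n)" and ?s = "real i / real (k n)" and ?t = "real (Suc i) / real (k n)"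
  let ?B = "(\<lambda>x. ?c *\<^sub>R x) -` A"
  have B: "?B \<in> sets borel"
    using measurable_sets[of "\<lambda>x::real ^ 'd. ?c *\<^sub>R x" borel borel A] by simp
  have st: "?t - ?s = 1 / real (k n)"
    by (simp add: diff_divide_distrib[symmetric])
  have "scaled_increment W k n (Suc i) -` A \<inter> space M = (\<lambda>\<omega>. W ?t \<omega> - W ?s \<omega>) -` ?B \<inter> space M"
    by (auto simp: scaled_increment_def)
  also have "emeasure M \<dots> =
      (\<integral>\<^sup>+x. ennreal (gaussian_density (?t - ?s) x) * indicator ?B x \<partial>lborel)"
    using assms B
    by (intro distributed_emeasure increment_distributed) (auto simp: divide_strict_right_mono)
  finally show ?thesis
    unfolding st by (simp add: indicator_def)
qed

text \<open>
  The law of the unscaled increment has variance \<open>1 / k(n)\<close>; its flattened version has variance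
  \<open>1 / (k(n) \<delta>)\<close>, and the last hypothesis says that this is the variance of a Brownian increment.
\<close>

lemma prob_rate_ge_le:
  assumes n: "1 \<le> n" and i: "i < k n" and \<delta>: "0 < \<delta>" "\<delta> \<le> 1" and k: "1 \<le> real (k n) * \<delta>"
  shows "prob (scaled_increment W k n (Suc i) -` {x. b \<le> rate x} \<inter> space M)
    \<le> \<delta> powr (- (real CARD('d) / 2)) * exp (- (real n * ((1 - \<delta>) * b)))" (is "prob ?E \<le> ?K")
proof -
  let ?v = "1 / real (k n)"
  have rate_meas: "{x::real ^ 'd. b \<le> rate x} \<in> sets borel"
    unfolding rate_def by measurable
  have v: "0 < ?v" using i by simp
  have "emeasure M ?E = (\<integral>\<^sup>+x. ennreal (gaussian_density ?v x) *
       indicator {x. b \<le> rate x} (sqrt (real (k n) / real n) *\<^sub>R (x :: real ^ 'd)) \<partial>lborel)"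
    by (rule emeasure_scaled_increment[OF n i rate_meas])
  also have "\<dots> \<le> (\<integral>\<^sup>+x. ennreal ?K * ennreal (gaussian_density (?v / \<delta>) (x :: real ^ 'd)) \<partial>lborel)"
  proof (rule nn_integral_mono)
    fix x :: "real ^ 'd"
    show "ennreal (gaussian_density ?v x) *
        indicator {x. b \<le> rate x} (sqrt (real (k n) / real n) *\<^sub>R x)
      \<le> ennreal ?K * ennreal (gaussian_density (?v / \<delta>) x)"
    proof (cases "b \<le> rate (sqrt (real (k n) / real n) *\<^sub>R x)")
      case True
      then have "real n * b \<le> (norm x)\<^sup>2 / (2 * ?v)"
        using n i by (simp add: rate_def power_mult_distrib field_simps)
      from gaussian_density_le_flattened[OF v \<delta> this] show ?thesis
        using True by (auto simp: ennreal_mult'[symmetric] gaussian_density_nonneg mult_ac intro!: ennreal_leI mult_left_mono)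
    qed simp
  qed
  also have "\<dots> = ennreal ?K"
    using nn_integral_gaussian_density[of "?v / \<delta>"] k i \<delta>
    by (subst nn_integral_cmult) (auto simp: field_simps)
  finally show ?thesis
    by (simp add: emeasure_eq_measure)
qed

text \<open>
  On a ball inside \<open>U\<close> the density of the scaled increment is at least a constant times
  \<open>exp (- n b)\<close>; the constant depends on neither \<open>n\<close> nor \<open>k\<close>.
\<close>

lemma prob_open_ge:
  fixes U :: "(real ^ 'd) set"
  assumes U: "open U" "U \<noteq> {}" and Ub: "U \<subseteq> {x. rate x < b}"
  obtains p where "0 < p" "\<And>n i. 1 \<le> n \<Longrightarrow> i < k n \<Longrightarrow>
    p * exp (- (real n * b)) \<le> prob (scaled_increment W k n (Suc i) -` U \<inter> space M)"
proof -
  obtain y s where s: "0 < s" and ys: "ball y s \<subseteq> U"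
    using U open_contains_ball by blast
  let ?e = "real CARD('d) / 2"
  define p where "p = unit_ball_vol (real CARD('d)) * s ^ CARD('d) * (2 * pi) powr (- ?e)"
  show thesis
  proof (rule that[of p])
    show "0 < p" using s by (simp add: p_def)
    fix n i :: nat assume n: "1 \<le> n" and i: "i < k n"
    let ?c = "sqrt (real (k n) / real n)" and ?v = "1 / real (k n)"
    have c: "0 < ?c" using n i by simp
    let ?g = "(2 * pi * ?v) powr (- ?e) * exp (- (real n * b))"
    let ?B = "ball (y /\<^sub>R ?c) (s / ?c)"
    have B: "?c *\<^sub>R x \<in> U" if "x \<in> ?B" for x
    proof -
      have "dist y (?c *\<^sub>R x) = dist (?c *\<^sub>R (y /\<^sub>R ?c)) (?c *\<^sub>R x)"
        using right_inverse[OF less_imp_neq[OF c, THEN not_sym]] by (simp only: scaleR_scaleR scaleR_one)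
      also have "\<dots> = ?c * dist (y /\<^sub>R ?c) x"
        by (simp only: dist_norm scaleR_diff_right[symmetric] norm_scaleR abs_of_pos[OF c])
      also have "\<dots> < s" using that c by (simp add: field_simps)
      finally show ?thesis using ys by auto
    qed
    (* The factor by which rescaling shrinks the ball and the height of the density combine to
       (2 pi / n) powr (- d / 2): the sample size cancels, and n >= 1 removes the rest of n. *)
    have "(2 * pi * ?v) powr (- ?e) * (s / ?c) ^ CARD('d) =
        s ^ CARD('d) * (2 * pi / real n) powr (- ?e)"
    proof -
      let ?q = "real (k n) / real n"
      have q: "0 < ?q" using n i by simp
      have "2 * pi * ?v = 2 * pi / real n / ?q" using n i by simp
      then have "(2 * pi * ?v) powr (- ?e) = (2 * pi / real n) powr (- ?e) / ?q powr (- ?e)"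
        using q by (simp only: powr_divide)
      also have "\<dots> = (2 * pi / real n) powr (- ?e) * ?q powr ?e"
        by (simp only: powr_minus divide_inverse inverse_inverse_eq)
      finally have *: "(2 * pi * ?v) powr (- ?e) = (2 * pi / real n) powr (- ?e) * ?q powr ?e" .
      have cancel: "x * z * (u / z) = u * x" if "0 < z" for x z u :: real
        using that by simp
      show ?thesis
        unfolding * power_divide sqrt_power_eq_powr[OF q] by (rule cancel) (use q in \<open>simp only: powr_gt_zero\<close>)
    qed
    also have "\<dots> \<ge> s ^ CARD('d) * (2 * pi) powr (- ?e)"
      using n s by (intro mult_left_mono powr_mono2') (auto simp: field_simps)
    finally have vol: "p * exp (- (real n * b)) \<le>
        ?g * (unit_ball_vol (real CARD('d)) * (s / ?c) ^ CARD('d))"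
      unfolding p_def by (simp add: mult_ac mult_left_mono)
    have "ennreal (p * exp (- (real n * b))) \<le> ennreal ?g * emeasure lborel ?B"
      using s c vol by (simp add: emeasure_ball ennreal_mult'[symmetric])
    also have "\<dots> = (\<integral>\<^sup>+x. ennreal ?g * indicator ?B x \<partial>lborel)"
      by (rule nn_integral_cmult_indicator[symmetric]) simp
    also have "\<dots> \<le> (\<integral>\<^sup>+x. ennreal (gaussian_density ?v x) * indicator U (?c *\<^sub>R x) \<partial>lborel)"
    proof (rule nn_integral_mono)
      fix x :: "real ^ 'd"
      show "ennreal ?g * indicator ?B x \<le> ennreal (gaussian_density ?v x) * indicator U (?c *\<^sub>R x)"
      proof (cases "x \<in> ?B")
        case True
        then have "rate (?c *\<^sub>R x) < b" using B Ub by blast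
        then have "(norm x)\<^sup>2 / (2 * ?v) \<le> real n * b"
          using n i by (simp add: rate_def power_mult_distrib field_simps)
        from gaussian_density_ge[OF this] show ?thesis
          using True B[OF True] by (simp add: ennreal_leI)
      qed simp
    qed
    also have "\<dots> = emeasure M (scaled_increment W k n (Suc i) -` U \<inter> space M)"
      using U by (intro emeasure_scaled_increment[OF n i, symmetric]) auto
    finally show "p * exp (- (real n * b)) \<le> prob (scaled_increment W k n (Suc i) -` U \<inter> space M)"
      by (simp add: emeasure_eq_measure)
  qed
qed

lemma measurable_hits:
  assumes "A \<in> sets borel"
  shows "(\<lambda>\<omega>. \<Sum>i<k n. indicator A (scaled_increment W k n (Suc i) \<omega>) :: real) \<in> borel_measurable M"
  using assms
  by (auto intro!: borel_measurable_sum
      measurable_compose[OF scaled_increment_measurable borel_measurable_indicator])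

text \<open>
  The slack \<open>b - a\<close> is spent in two halves: \<open>\<delta>\<close> is chosen so small that flattening costs at most one
  half, and the other half makes the bound from Markov's inequality summable. The growth of \<open>k\<close>
  makes the flattened variance \<open>1 / (k(n) \<delta>)\<close> at most \<open>1\<close>.
\<close>

lemma AE_empirical_rate_ge_le:
  assumes ab: "a < b" and k_lim: "filterlim (\<lambda>n. real (k n)) at_top sequentially"
  shows "AE \<omega> in M. \<exists>C>0. \<forall>\<^sub>F n in sequentially.
    measure (empirical_measure W k n \<omega>) {x. b \<le> rate x} \<le> C * exp (- (real n * a))"
proof -
  let ?A = "{x::real ^ 'd. b \<le> rate x}"
  have A: "?A \<in> sets borel"
    unfolding rate_def by measurable
  define \<delta> where "\<delta> = min 1 ((b - a) / (2 * (\<bar>b\<bar> + 1)))"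
  define c where "c = (b - a) / 2"
  have c: "0 < c" using ab by (simp add: c_def)
  have \<delta>: "0 < \<delta>" "\<delta> \<le> 1" using ab by (auto simp: \<delta>_def)
  have "\<delta> * b \<le> \<delta> * (\<bar>b\<bar> + 1)" using \<delta> by (intro mult_left_mono) auto
  also have "\<dots> \<le> (b - a) / (2 * (\<bar>b\<bar> + 1)) * (\<bar>b\<bar> + 1)"
    by (intro mult_right_mono) (auto simp: \<delta>_def)
  also have "\<dots> = c" by (simp add: c_def field_simps)
  finally have gap: "a + c \<le> (1 - \<delta>) * b" by (simp add: c_def field_simps)
  define C where "C = \<delta> powr (- (real CARD('d) / 2))"
  have C: "0 < C" using \<delta> by (simp add: C_def)
  let ?S = "\<lambda>n \<omega>. \<Sum>i<k n. indicator ?A (scaled_increment W k n (Suc i) \<omega>) :: real"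
  let ?a = "\<lambda>n. real (k n) * (C * exp (- (real n * a)))"
  let ?E = "\<lambda>n. {\<omega> \<in> space M. ?a n \<le> ?S n \<omega>}"
  have "\<forall>\<^sub>F n in sequentially. 1 / \<delta> \<le> real (k n)"
    using k_lim by (simp add: filterlim_at_top)
  then have "\<forall>\<^sub>F n in sequentially. prob (?E n) \<le> 1 * exp (- (real n * c))"
    using eventually_ge_at_top[of 1]
  proof eventually_elim
    case (elim n)
    have k: "1 \<le> real (k n) * \<delta>" using elim \<delta> by (simp add: field_simps)
    have kn: "0 < real (k n)" using k_pos elim by simp
    have "prob (?E n) \<le> real (card {..<k n}) * (C * exp (- (real n * ((1 - \<delta>) * b)))) / ?a n"
      unfolding C_def
      by (intro prob_many_hits_le)
        (use prob_rate_ge_le[OF _ _ \<delta> k] A elim \<delta> kn in \<open>auto\<close>)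
    also have "\<dots> = exp (- (real n * ((1 - \<delta>) * b))) / exp (- (real n * a))"
      using kn C by simp
    also have "\<dots> = exp (- (real n * ((1 - \<delta>) * b)) - - (real n * a))"
      by (rule exp_diff[symmetric])
    also have "\<dots> \<le> exp (- (real n * c))"
      using mult_left_mono[OF gap, of "real n"] by (simp add: algebra_simps)
    finally show ?case by simp
  qed
  then have "AE \<omega> in M. \<forall>\<^sub>F n in sequentially. \<omega> \<notin> ?E n"
    by (rule AE_eventually_not_of_exponential_decay[rotated 2]) (use measurable_hits[OF A] c in auto)
  then show ?thesis
    using AE_space
  proof eventually_elim
    case (elim \<omega>)
    have "\<forall>\<^sub>F n in sequentially. measure (empirical_measure W k n \<omega>) ?A \<le> C * exp (- (real n * a))"
      using elim(1) eventually_ge_at_top[of 1]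
    proof eventually_elim
      case (elim n)
      then show ?case
        using \<open>\<omega> \<in> space M\<close> k_pos[of n]
        by (simp add: measure_empirical_measure[OF A] field_simps)
    qed
    then show ?case using C by blast
  qed
qed

text \<open>
  The expected number of points in \<open>U\<close> is eventually at least \<open>p exp (n (\<beta> - b))\<close>. The Chernoff bound is the
  exponential of minus a quarter of that, and the estimate \<open>exp (- z) \<le> 1 / z\<close> already leaves enough
  for Borel--Cantelli.
\<close>

lemma AE_empirical_open_ge:
  fixes U :: "(real ^ 'd) set"
  assumes U: "open U" "U \<noteq> {}" "U \<subseteq> {x. rate x < b}" and b: "b < \<beta>"
    and k_large: "\<forall>\<^sub>F n in sequentially. exp (real n * \<beta>) \<le> real (k n)"
  shows "AE \<omega> in M. \<exists>C>0. \<forall>\<^sub>F n in sequentially.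
    C * exp (- (real n * b)) \<le> measure (empirical_measure W k n \<omega>) U"
proof -
  have A: "U \<in> sets borel" using U by simp
  obtain p where p: "0 < p" and p_le: "\<And>n i. 1 \<le> n \<Longrightarrow> i < k n \<Longrightarrow>
      p * exp (- (real n * b)) \<le> prob (scaled_increment W k n (Suc i) -` U \<inter> space M)"
    using prob_open_ge[OF U] by blast
  let ?S = "\<lambda>n \<omega>. \<Sum>i<k n. indicator U (scaled_increment W k n (Suc i) \<omega>) :: real"
  let ?a = "\<lambda>n. real (k n) * (p * exp (- (real n * b))) / 4"
  let ?E = "\<lambda>n. {\<omega> \<in> space M. ?S n \<omega> \<le> ?a n}"
  have "\<forall>\<^sub>F n in sequentially. prob (?E n) \<le> 4 / p * exp (- (real n * (\<beta> - b)))"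
    using k_large eventually_ge_at_top[of 1]
  proof eventually_elim
    case (elim n)
    have "prob (?E n) \<le> exp (- ?a n)"
      using prob_few_hits_le[OF _ indep_scaled_increments A p_le, of n] elim by simp
    also have "\<dots> \<le> exp (- (p / 4 * exp (real n * (\<beta> - b))))"
    proof -
      have "exp (real n * (\<beta> - b)) = exp (real n * \<beta>) * exp (- (real n * b))"
        by (simp add: exp_add[symmetric] right_diff_distrib)
      then have "p / 4 * exp (real n * (\<beta> - b)) = exp (real n * \<beta>) * (p * exp (- (real n * b)) / 4)"
        by (simp only: times_divide_eq_left times_divide_eq_right mult.left_commute)
      also have "\<dots> \<le> real (k n) * (p * exp (- (real n * b)) / 4)"
        using p by (intro mult_right_mono[OF elim(1)]) simp
      finally show ?thesis by simp
    qed
    also have "\<dots> \<le> inverse (p / 4 * exp (real n * (\<beta> - b)))"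
      using p by (intro exp_minus_le_inverse) simp
    also have "\<dots> = 4 / p * exp (- (real n * (\<beta> - b)))"
      by (simp only: exp_minus inverse_mult_distrib inverse_divide)
    finally show ?case .
  qed
  then have "AE \<omega> in M. \<forall>\<^sub>F n in sequentially. \<omega> \<notin> ?E n"
    by (rule AE_eventually_not_of_exponential_decay[rotated 2]) (use measurable_hits[OF A] b in auto)
  then show ?thesis
    using AE_space
  proof eventually_elim
    case (elim \<omega>)
    have "\<forall>\<^sub>F n in sequentially. p / 4 * exp (- (real n * b)) \<le> measure (empirical_measure W k n \<omega>) U"
      using elim(1) eventually_ge_at_top[of 1]
    proof eventually_elim
      case (elim n)
      then show ?case
        using \<open>\<omega> \<in> space M\<close> k_pos[of n]
        by (simp add: measure_empirical_measure[OF A] field_simps)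
    qed
    then show ?case using p by (intro exI[of _ "p / 4"]) simp
  qed
qed

lemma empirical_measure_mono:
  assumes "A \<subseteq> B" "A \<in> sets borel" "B \<in> sets borel"
  shows "measure (empirical_measure W k n \<omega>) A \<le> measure (empirical_measure W k n \<omega>) B"
  unfolding measure_empirical_measure[OF assms(2)] measure_empirical_measure[OF assms(3)]
  using assms(1) by (intro divide_right_mono sum_mono) (auto simp: indicator_def)

text \<open>
  Two rationals are inserted below the infimum: \<open>b\<close> describes a set containing \<open>\<Gamma>\<close>, and \<open>a < b\<close> is the
  rate that this set is known to have. For empty \<open>\<Gamma>\<close> the infimum is \<open>\<infinity>\<close> and every \<open>b\<close> is admissible.
\<close>

lemma AE_limsup_empirical_le:
  assumes k_lim: "filterlim (\<lambda>n. real (k n)) at_top sequentially"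
  shows "AE \<omega> in M. \<forall>\<Gamma>\<in>sets borel.
    limsup (\<lambda>n. ereal (1 / real n) * elog (measure (empirical_measure W k n \<omega>) \<Gamma>))
      \<le> - (INF x\<in>closure \<Gamma>. ereal (rate x))"
proof -
  have "AE \<omega> in M. \<forall>a b :: rat. a < b \<longrightarrow> (\<exists>C>0. \<forall>\<^sub>F n in sequentially.
    measure (empirical_measure W k n \<omega>) {x. real_of_rat b \<le> rate x} \<le> C * exp (- (real n * real_of_rat a)))"
    using AE_empirical_rate_ge_le[OF _ k_lim] by (auto simp: AE_all_countable of_rat_less)
  then show ?thesis
  proof eventually_elim
    case (elim \<omega>)
    show ?case
    proof
      fix \<Gamma> :: "(real ^ 'd) set" assume \<Gamma>: "\<Gamma> \<in> sets borel"
      let ?m = "\<lambda>n. measure (empirical_measure W k n \<omega>)"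
      let ?L = "limsup (\<lambda>n. ereal (1 / real n) * elog (?m n \<Gamma>))"
      have "(INF x\<in>closure \<Gamma>. ereal (rate x)) \<le> - ?L"
      proof (rule dense_le)
        fix y assume "y < (INF x\<in>closure \<Gamma>. ereal (rate x))"
        then obtain b where b: "y < real_of_rat b" "real_of_rat b < (INF x\<in>closure \<Gamma>. ereal (rate x))"
          using ereal_dense3 by blast
        obtain a where a: "y < real_of_rat a" "ereal (real_of_rat a) < real_of_rat b"
          using ereal_dense3[OF b(1)] by blast
        have sub: "\<Gamma> \<subseteq> {x. real_of_rat b \<le> rate x}"
        proof
          fix x assume "x \<in> \<Gamma>"
          then have "x \<in> closure \<Gamma>" using closure_subset by blast
          then have "(INF x\<in>closure \<Gamma>. ereal (rate x)) \<le> ereal (rate x)" by (rule INF_lower)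
          with b(2) have "ereal (real_of_rat b) < ereal (rate x)" by (rule less_le_trans)
          then show "x \<in> {x. real_of_rat b \<le> rate x}" by simp
        qed
        have "a < b" using a(2) by (simp add: of_rat_less)
        then obtain C where C: "0 < C" "\<forall>\<^sub>F n in sequentially.
            ?m n {x. real_of_rat b \<le> rate x} \<le> C * exp (- (real n * real_of_rat a))"
          using elim by blast
        have A: "{x::real ^ 'd. real_of_rat b \<le> rate x} \<in> sets borel"
          unfolding rate_def by measurable
        have "\<forall>\<^sub>F n in sequentially. ?m n \<Gamma> \<le> C * exp (- (real n * real_of_rat a))"
          using C(2) by eventually_elim (use empirical_measure_mono[OF sub \<Gamma> A] order_trans in blast)
        then have "?L \<le> ereal (- real_of_rat a)"
          by (rule limsup_rescaled_elog_le[OF C(1)]) simp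
        then have "ereal (real_of_rat a) \<le> - ?L"
          using ereal_minus_le_minus[of "ereal (- real_of_rat a)" ?L] by simp
        then show "y \<le> - ?L" using a(1) by simp
      qed
      then show "?L \<le> - (INF x\<in>closure \<Gamma>. ereal (rate x))"
        using ereal_minus_le_minus[of "- ?L" "INF x\<in>closure \<Gamma>. ereal (rate x)"] by simp
    qed
  qed
qed

text \<open>
  The margin \<open>b < \<beta>\<close> that makes the expected counts grow is available at every interior point \<open>x\<close> because
  the ball is open, so \<open>rate x < \<beta>\<close> strictly. On the sphere \<open>rate x = \<beta>\<close> there would be no such \<open>b\<close>.
\<close>

lemma AE_liminf_empirical_ge:
  assumes k_large: "\<forall>\<^sub>F n in sequentially. exp (real n * \<beta>) \<le> real (k n)"
  shows "AE \<omega> in M. \<forall>\<Gamma>\<in>sets borel. \<Gamma> \<subseteq> {x. rate x < \<beta>} \<longrightarrow>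
    - (INF x\<in>interior \<Gamma>. ereal (rate x))
      \<le> liminf (\<lambda>n. ereal (1 / real n) * elog (measure (empirical_measure W k n \<omega>) \<Gamma>))"
proof -
  obtain \<B> :: "(real ^ 'd) set set" where \<B>: "countable \<B>" "topological_basis \<B>"
    using ex_countable_basis by blast
  have "AE \<omega> in M. \<forall>b::rat. \<forall>U\<in>\<B>. U \<noteq> {} \<and> U \<subseteq> {x. rate x < real_of_rat b} \<and> real_of_rat b < \<beta> \<longrightarrow>
    (\<exists>C>0. \<forall>\<^sub>F n in sequentially.
      C * exp (- (real n * real_of_rat b)) \<le> measure (empirical_measure W k n \<omega>) U)"
    unfolding AE_all_countable AE_ball_countable[OF \<B>(1)]
  proof (intro allI ballI)
    fix b :: rat and U assume "U \<in> \<B>"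
    then have "open U" by (rule topological_basis_open[OF \<B>(2)])
    show "AE \<omega> in M. U \<noteq> {} \<and> U \<subseteq> {x. rate x < real_of_rat b} \<and> real_of_rat b < \<beta> \<longrightarrow>
        (\<exists>C>0. \<forall>\<^sub>F n in sequentially.
          C * exp (- (real n * real_of_rat b)) \<le> measure (empirical_measure W k n \<omega>) U)"
    proof (rule AE_impI, elim conjE)
      assume "U \<noteq> {}" "U \<subseteq> {x. rate x < real_of_rat b}" "real_of_rat b < \<beta>"
      with \<open>open U\<close> show "AE \<omega> in M. \<exists>C>0. \<forall>\<^sub>F n in sequentially.
          C * exp (- (real n * real_of_rat b)) \<le> measure (empirical_measure W k n \<omega>) U"
        using k_large by (rule AE_empirical_open_ge)
    qed
  qed
  then show ?thesis
  proof eventually_elim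
    case (elim \<omega>)
    show ?case
    proof (intro ballI impI)
      fix \<Gamma> :: "(real ^ 'd) set" assume \<Gamma>: "\<Gamma> \<in> sets borel" "\<Gamma> \<subseteq> {x. rate x < \<beta>}"
      let ?m = "\<lambda>n. measure (empirical_measure W k n \<omega>)"
      let ?L = "liminf (\<lambda>n. ereal (1 / real n) * elog (?m n \<Gamma>))"
      have "- ?L \<le> (INF x\<in>interior \<Gamma>. ereal (rate x))"
      proof (rule INF_greatest, rule dense_ge)
        fix x y assume x: "x \<in> interior \<Gamma>" and y: "ereal (rate x) < y"
        have "rate x < \<beta>"
          using x \<Gamma>(2) interior_subset[of \<Gamma>] by blast
        with y have "ereal (rate x) < min y (ereal \<beta>)"
          by (simp only: min_less_iff_conj less_ereal.simps(1) simp_thms)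
        from ereal_dense3[OF this] obtain b where "ereal (rate x) < ereal (real_of_rat b)"
            "ereal (real_of_rat b) < min y (ereal \<beta>)"
          by blast
        then have b: "rate x < real_of_rat b" "ereal (real_of_rat b) < y" "real_of_rat b < \<beta>"
          by (simp_all only: min_less_iff_conj less_ereal.simps(1))
        have "open {x::real ^ 'd. rate x < real_of_rat b}"
          unfolding rate_def by (intro open_Collect_less continuous_intros) simp
        then have "open (interior \<Gamma> \<inter> {x. rate x < real_of_rat b})"
          by auto
        then obtain U where U: "U \<in> \<B>" "x \<in> U" "U \<subseteq> interior \<Gamma> \<inter> {x. rate x < real_of_rat b}"
          using topological_basisE[OF \<B>(2), of _ x] x b(1) by blast
        then have "U \<noteq> {} \<and> U \<subseteq> {x. rate x < real_of_rat b} \<and> real_of_rat b < \<beta>"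
          using b(3) by blast
        then obtain C where C: "0 < C" "\<forall>\<^sub>F n in sequentially.
            C * exp (- (real n * real_of_rat b)) \<le> ?m n U"
          using elim[rule_format, OF U(1)] by blast
        have sub: "U \<subseteq> \<Gamma>" using U interior_subset by blast
        have Ub: "U \<in> sets borel" using topological_basis_open[OF \<B>(2) U(1)] by simp
        have "\<forall>\<^sub>F n in sequentially. C * exp (- (real n * real_of_rat b)) \<le> ?m n \<Gamma>"
          using C(2) by eventually_elim (use empirical_measure_mono[OF sub Ub \<Gamma>(1)] order_trans in blast)
        then have "ereal (- real_of_rat b) \<le> ?L"
          by (rule liminf_rescaled_elog_ge[OF C(1)])
        then have "- ?L \<le> ereal (real_of_rat b)"
          using ereal_uminus_le_reorder[of ?L "ereal (real_of_rat b)"] by simp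
        also have "\<dots> \<le> y" using b(2) by (rule less_imp_le)
        finally show "- ?L \<le> y" .
      qed
      then show "- (INF x\<in>interior \<Gamma>. ereal (rate x)) \<le> ?L"
        by (rule ereal_uminus_le_reorder[THEN iffD1])
    qed
  qed
qed

end

section \<open>The growth of the sample size and the conclusion\<close>

text \<open>
  Once a term of the series is below \<open>1\<close> and \<open>\<epsilon> n < 1\<close>, its exponential factor is below
  \<open>\<epsilon> n < 1\<close>, so the bracket is positive.
\<close>

lemma sample_size_eventually_large:
  fixes k :: "nat \<Rightarrow> nat" and \<epsilon> :: "nat \<Rightarrow> real"
  assumes k: "\<forall>n\<ge>1. 0 < k n" and \<epsilon>: "\<forall>n\<ge>1. 0 < \<epsilon> n" "\<epsilon> \<longlonglongrightarrow> 0"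
    and sum: "(\<lambda>n. exp (- (sqrt (\<epsilon> n) * (ln (real (k n)) - real n * (1 + sqrt (\<epsilon> n)) * R\<^sup>2 / 2)))
                * inverse (\<epsilon> n)) summable_on {1..}"
  shows "\<forall>\<^sub>F n in sequentially. exp (real n * (R\<^sup>2 / 2)) \<le> real (k n)"
proof -
  let ?L = "\<lambda>n. ln (real (k n)) - real n * (1 + sqrt (\<epsilon> n)) * R\<^sup>2 / 2"
  let ?f = "\<lambda>n. exp (- (sqrt (\<epsilon> n) * ?L n)) * inverse (\<epsilon> n)"
  have "(\<lambda>n. if n \<in> {1..} then ?f n else 0) summable_on UNIV"
    using sum by (subst summable_on_cong_neutral[where T = "{1..}" and g = ?f]) auto
  then have "(\<lambda>n. if n \<in> {1..} then ?f n else 0) \<longlonglongrightarrow> 0"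
    by (intro summable_LIMSEQ_zero summable_on_imp_summable)
  then have "\<forall>\<^sub>F n in sequentially. (if n \<in> {1..} then ?f n else 0) < 1"
    by (rule order_tendstoD) simp
  moreover have "\<forall>\<^sub>F n in sequentially. \<epsilon> n < 1"
    using \<epsilon>(2) by (rule order_tendstoD) simp
  ultimately show ?thesis
    using eventually_ge_at_top[of 1]
  proof eventually_elim
    case (elim n)
    have e: "0 < \<epsilon> n" using \<epsilon> elim by simp
    have kn: "0 < real (k n)" using k elim by simp
    have "exp (- (sqrt (\<epsilon> n) * ?L n)) / \<epsilon> n < 1"
      using elim by (simp only: atLeast_iff if_True divide_inverse)
    then have "exp (- (sqrt (\<epsilon> n) * ?L n)) < \<epsilon> n"
      by (simp only: pos_divide_less_eq[OF e] mult_1)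
    also have "\<dots> < exp 0" using elim by simp
    finally have "0 < sqrt (\<epsilon> n) * ?L n" by (simp only: exp_less_cancel_iff neg_less_0_iff_less)
    then have "0 < ?L n" using e by (simp add: zero_less_mult_iff)
    moreover have "real n * (R\<^sup>2 / 2) * 1 \<le> real n * (R\<^sup>2 / 2) * (1 + sqrt (\<epsilon> n))"
      using e by (intro mult_left_mono) simp_all
    moreover have "real n * (R\<^sup>2 / 2) * (1 + sqrt (\<epsilon> n)) = real n * (1 + sqrt (\<epsilon> n)) * R\<^sup>2 / 2"
      by simp
    ultimately have "real n * (R\<^sup>2 / 2) \<le> ln (real (k n))"
      unfolding mult_1_right by linarith
    then show ?case by (rule ln_ge_iff[OF kn, THEN iffD1])
  qed
qed

theorem theorem3p1:
  fixes M :: "'a measure"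
    and W :: "real \<Rightarrow> 'a \<Rightarrow> real ^ 'd"
    and k :: "nat \<Rightarrow> nat"
    and R :: real
  assumes "standard_brownian_motion M W"
    and "\<forall>n\<ge>1. 0 < k n"
    and "0 < R"
    and "\<exists>\<epsilon> :: nat \<Rightarrow> real.
           (\<forall>n\<ge>1. 0 < \<epsilon> n) \<and> \<epsilon> \<longlonglongrightarrow> 0 \<and>
           (\<lambda>n. exp (- (sqrt (\<epsilon> n) * (ln (real (k n)) - real n * (1 + sqrt (\<epsilon> n)) * R\<^sup>2 / 2)))
                * inverse (\<epsilon> n)) summable_on {1..}"
  shows "AE \<omega> in M. \<forall>\<Gamma> \<in> sets borel. \<Gamma> \<subseteq> {x. norm x < R} \<longrightarrow>
           - (INF x\<in>interior \<Gamma>. ereal (rate x))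
             \<le> liminf (\<lambda>n. ereal (1 / real n) * elog (measure (empirical_measure W k n \<omega>) \<Gamma>)) \<and>
           liminf (\<lambda>n. ereal (1 / real n) * elog (measure (empirical_measure W k n \<omega>) \<Gamma>))
             \<le> limsup (\<lambda>n. ereal (1 / real n) * elog (measure (empirical_measure W k n \<omega>) \<Gamma>)) \<and>
           limsup (\<lambda>n. ereal (1 / real n) * elog (measure (empirical_measure W k n \<omega>) \<Gamma>))
             \<le> - (INF x\<in>closure \<Gamma>. ereal (rate x))"
proof -
  interpret prob_space M
    using assms(1) by (simp add: standard_brownian_motion_def)
  interpret brownian_increments M W k
    using assms(1,2) by unfold_locales auto
  have k_large: "\<forall>\<^sub>F n in sequentially. exp (real n * (R\<^sup>2 / 2)) \<le> real (k n)"
    using assms(4) sample_size_eventually_large[OF assms(2)] by blast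
  have "filterlim (\<lambda>n. exp (real n * (R\<^sup>2 / 2))) at_top sequentially"
    using assms(3)
    by (intro filterlim_compose[OF exp_at_top] filterlim_at_top_mult_tendsto_pos[OF tendsto_const])
      (auto intro: filterlim_real_sequentially simp: mult.commute)
  then have k_lim: "filterlim (\<lambda>n. real (k n)) at_top sequentially"
    using k_large by (rule filterlim_at_top_mono)
  have ball: "{x::real ^ 'd. norm x < R} \<subseteq> {x. rate x < R\<^sup>2 / 2}"
    by (auto simp: rate_def intro: power_strict_mono)
  show ?thesis
    using AE_limsup_empirical_le[OF k_lim] AE_liminf_empirical_ge[OF k_large]
  proof eventually_elim
    case (elim \<omega>)
    show ?case
    proof (intro ballI impI conjI)
      fix \<Gamma> :: "(real ^ 'd) set" assume \<Gamma>: "\<Gamma> \<in> sets borel" "\<Gamma> \<subseteq> {x. norm x < R}"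
      let ?f = "\<lambda>n. ereal (1 / real n) * elog (measure (empirical_measure W k n \<omega>) \<Gamma>)"
      show "- (INF x\<in>interior \<Gamma>. ereal (rate x)) \<le> liminf ?f"
        using elim(2) \<Gamma>(1) subset_trans[OF \<Gamma>(2) ball] by blast
      show "liminf ?f \<le> limsup ?f"
        by (rule Liminf_le_Limsup) simp
      show "limsup ?f \<le> - (INF x\<in>closure \<Gamma>. ereal (rate x))"
        using elim(1) \<Gamma>(1) by blast
    qed
  qed
qed

end
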